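(* Let $(\mathcal{A},\cdot)$ be a commutative associative algebra over $\mathbb{C}$, let $d_1,d_2$ be mutually commuting derivations of $(\mathcal{A},\cdot)$, and let $b\in\mathbb{C}$ be a constant. For $i,j\in\{1,2\}$, $c\in\mathbb{C}$ and $u,v\in\mathcal{A}$ put $$[u,v]_{i,j}=d_i(u)d_j(v)-d_j(u)d_i(v),\quad [u,v]_i=u\,d_i(v)-d_i(u)v,\quad u\circ_{i,c}v=u\,(d_i(v)+cv).$$ Then $(\mathcal{A},[\cdot,\cdot]_{1,2}+[\cdot,\cdot]_2,\circ_{2,0})$ and $(\mathcal{A},[\cdot,\cdot]_{2,1}+b[\cdot,\cdot]_1,\circ_{2,b})$ are Gel'fand-Dorfman bialgebras.
   Context: A Novikov algebra $(\mathcal{A},\circ)$ (over $\mathbb{C}$) is a vector space with a bilinear operation satisfying $(u\circ v)\circ w=(u\circ w)\circ v$ and $(u,v,w)=(v,u,w)$, where $(u,v,w)=(u\circ v)\circ w-u\circ(v\circ w)$. A Gel'fand-Dorfman bialgebra is a triple $(\mathcal{A},[\cdot,\cdot],\circ)$ such that $(\mathcal{A},[\cdot,\cdot])$ is a Lie algebra, $(\mathcal{A},\circ)$ is a Novikov algebra and $$[w\circ u,v]-[w\circ v,u]+[w,u]\circ v-[w,v]\circ u-w\circ[u,v]=0\quad\text{for all }u,v,w\in\mathcal{A}.$$ *)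

theory Defs
  imports Complex_Main
begin

text \<open>An algebra over the complex numbers in the weakest sense: a vector space with a bilinear
  operation, neither associative nor unital. The vector space is the whole type, with
  an explicit scalar multiplication.\<close>

locale complex_algebra = vector_space scale
  for scale :: "complex \<Rightarrow> 'a::ab_group_add \<Rightarrow> 'a" +
  fixes mult :: "'a \<Rightarrow> 'a \<Rightarrow> 'a"
  assumes linear_left: "Vector_Spaces.linear scale scale (\<lambda>u. mult u v)"
    and linear_right: "Vector_Spaces.linear scale scale (\<lambda>v. mult u v)"

locale comm_assoc_algebra = complex_algebra scale mult
  for scale :: "complex \<Rightarrow> 'a::ab_group_add \<Rightarrow> 'a" and mult :: "'a \<Rightarrow> 'a \<Rightarrow> 'a" +
  assumes commute: "mult u v = mult v u"
    and assoc: "mult (mult u v) w = mult u (mult v w)"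

locale derivation = complex_algebra scale mult
  for scale :: "complex \<Rightarrow> 'a::ab_group_add \<Rightarrow> 'a" and mult :: "'a \<Rightarrow> 'a \<Rightarrow> 'a" +
  fixes d :: "'a \<Rightarrow> 'a"
  assumes linear_derivation: "Vector_Spaces.linear scale scale d"
    and Leibniz: "d (mult u v) = mult (d u) v + mult u (d v)"

locale lie_algebra = complex_algebra scale br
  for scale :: "complex \<Rightarrow> 'a::ab_group_add \<Rightarrow> 'a" and br :: "'a \<Rightarrow> 'a \<Rightarrow> 'a" +
  assumes alternating: "br u u = 0"
    and Jacobi: "br u (br v w) + br v (br w u) + br w (br u v) = 0"

definition associator :: "('a::ab_group_add \<Rightarrow> 'a \<Rightarrow> 'a) \<Rightarrow> 'a \<Rightarrow> 'a \<Rightarrow> 'a \<Rightarrow> 'a" where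
  "associator circ u v w = circ (circ u v) w - circ u (circ v w)"

locale novikov_algebra = complex_algebra scale circ
  for scale :: "complex \<Rightarrow> 'a::ab_group_add \<Rightarrow> 'a" and circ :: "'a \<Rightarrow> 'a \<Rightarrow> 'a" +
  assumes right_commutative: "circ (circ u v) w = circ (circ u w) v"
    and left_symmetric: "associator circ u v w = associator circ v u w"

locale gelfand_dorfman_bialgebra = lie_algebra scale br + novikov_algebra scale circ
  for scale :: "complex \<Rightarrow> 'a::ab_group_add \<Rightarrow> 'a"
    and br :: "'a \<Rightarrow> 'a \<Rightarrow> 'a" and circ :: "'a \<Rightarrow> 'a \<Rightarrow> 'a" +
  assumes compatibility:
    "br (circ w u) v - br (circ w v) u + circ (br w u) v - circ (br w v) u - circ w (br u v) = 0"

text \<open>The operations \<open>[u,v]\<^sub>i\<^sub>,\<^sub>j\<close>, \<open>[u,v]\<^sub>i\<close> and \<open>u \<circ>\<^sub>i\<^sub>,\<^sub>c v\<close>, with the maps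
  \<open>d\<^sub>i\<close>, \<open>d\<^sub>j\<close> themselves as arguments in place of the indices.\<close>

definition bracket2 :: "('a::ab_group_add \<Rightarrow> 'a \<Rightarrow> 'a) \<Rightarrow> ('a \<Rightarrow> 'a) \<Rightarrow> ('a \<Rightarrow> 'a) \<Rightarrow> 'a \<Rightarrow> 'a \<Rightarrow> 'a" where
  "bracket2 mult di dj u v = mult (di u) (dj v) - mult (dj u) (di v)"

definition bracket1 :: "('a::ab_group_add \<Rightarrow> 'a \<Rightarrow> 'a) \<Rightarrow> ('a \<Rightarrow> 'a) \<Rightarrow> 'a \<Rightarrow> 'a \<Rightarrow> 'a" where
  "bracket1 mult di u v = mult u (di v) - mult (di u) v"

definition novikov_product ::
  "(complex \<Rightarrow> 'a::ab_group_add \<Rightarrow> 'a) \<Rightarrow> ('a \<Rightarrow> 'a \<Rightarrow> 'a) \<Rightarrow> ('a \<Rightarrow> 'a) \<Rightarrow> complex \<Rightarrow> 'a \<Rightarrow> 'a \<Rightarrow> 'a" where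
  "novikov_product scale mult di c u v = mult u (di v + scale c v)"

end

(* Put D = d2 + b and E = d1 + e with scalars b, e. A shifted derivation d + c satisfies
   D (u v) = D u v + u D v - c u v, and the corrections by c cancel in every identity that is needed.
   Hence (Du Ev - Eu Dv, u Dv) is a Gel'fand-Dorfman bialgebra for all b and e. The first structure
   is the case b = 0, e = 1 with the opposite bracket, and the second one
   is the case e = 0. *)
theory Submission
  imports Defs
begin

context complex_algebra
begin

lemma add_left: "mult (u + v) w = mult u w + mult v w"
  using linear_left[of w] by (simp add: Vector_Spaces.linear_iff)

lemma add_right: "mult u (v + w) = mult u v + mult u w"
  using linear_right[of u] by (simp add: Vector_Spaces.linear_iff)

lemma scale_left: "mult (scale c u) v = scale c (mult u v)"
  using linear_left[of v] by (simp add: Vector_Spaces.linear_iff)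

lemma scale_right: "mult u (scale c v) = scale c (mult u v)"
  using linear_right[of u] by (simp add: Vector_Spaces.linear_iff)

lemma diff_left: "mult (u - v) w = mult u w - mult v w"
  using add_left[of "u - v" v w] by (simp add: algebra_simps)

lemma diff_right: "mult u (v - w) = mult u v - mult u w"
  using add_right[of u "v - w" w] by (simp add: algebra_simps)

lemmas bilinear_simps = add_left add_right diff_left diff_right scale_left scale_right

end

lemma complex_algebraI:
  assumes "vector_space scale"
    and "\<And>u v w. mult (u + v) w = mult u w + mult v w"
    and "\<And>u v w. mult u (v + w) = mult u v + mult u w"
    and "\<And>c u v. mult (scale c u) v = scale c (mult u v)"
    and "\<And>c u v. mult u (scale c v) = scale c (mult u v)"
  shows "complex_algebra scale mult"
  using assms by (simp add: complex_algebra_def complex_algebra_axioms_def Vector_Spaces.linear_iff)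

text \<open>With \<open>assoc\<close> and \<open>commute\<close> this sorts products, so identities
  between expanded expressions reduce to cancelling equal monomials.\<close>

lemma (in comm_assoc_algebra) left_commute: "mult u (mult v w) = mult v (mult u w)"
  by (metis assoc commute)

text \<open>Axiomatizing the sum \<open>D\<close> of a derivation and a scalar, rather than its
  summands, keeps expansions in terms of \<open>D\<close>; the scalar enters only through the
  Leibniz rule.\<close>

locale shifted_derivation = comm_assoc_algebra scale mult
  for scale :: "complex \<Rightarrow> 'a::ab_group_add \<Rightarrow> 'a" and mult :: "'a \<Rightarrow> 'a \<Rightarrow> 'a" +
  fixes shift :: complex and D :: "'a \<Rightarrow> 'a"
  assumes linear_shifted: "Vector_Spaces.linear scale scale D"
    and shifted_Leibniz: "D (mult u v) = mult (D u) v + mult u (D v) - scale shift (mult u v)"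
begin

lemma shifted_add: "D (u + v) = D u + D v"
  using linear_shifted by (simp add: Vector_Spaces.linear_iff)

lemma shifted_scale: "D (scale c u) = scale c (D u)"
  using linear_shifted by (simp add: Vector_Spaces.linear_iff)

lemma shifted_diff: "D (u - v) = D u - D v"
  using shifted_add[of "u - v" v] by (simp add: algebra_simps)

lemmas shifted_simps = shifted_add shifted_diff shifted_scale shifted_Leibniz

text \<open>The associator of \<open>u\<close>, \<open>v\<close>, \<open>w\<close> collapses to
  shift * u v Dw - u v DDw, which is symmetric in \<open>u\<close> and \<open>v\<close>.\<close>

lemma novikov_algebra_shifted: "novikov_algebra scale (\<lambda>u v. mult u (D v))"
proof -
  interpret circ: complex_algebra scale "\<lambda>u v. mult u (D v)"
    by (rule complex_algebraI[OF vector_space_axioms]) (simp_all add: bilinear_simps shifted_simps)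
  show ?thesis
    by unfold_locales
      (simp_all add: associator_def bilinear_simps shifted_simps assoc commute left_commute
        algebra_simps)
qed

end

lemma (in comm_assoc_algebra) shifted_derivationI:
  assumes "derivation scale mult d"
  shows "shifted_derivation scale mult c (\<lambda>u. d u + scale c u)"
proof -
  interpret derivation scale mult d by (fact assms)
  have "d (u + v) = d u + d v" "d (scale r u) = scale r (d u)" for u v r
    using linear_derivation by (simp_all add: Vector_Spaces.linear_iff)
  then have "Vector_Spaces.linear scale scale (\<lambda>u. d u + scale c u)"
    by (simp add: Vector_Spaces.linear_iff vector_space_axioms algebra_simps)
  then show ?thesis
  proof (intro shifted_derivation.intro shifted_derivation_axioms.intro comm_assoc_algebra_axioms)
    show "d (mult u v) + scale c (mult u v)
        = mult (d u + scale c u) v + mult u (d v + scale c v) - scale c (mult u v)" for u v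
      by (simp add: Leibniz bilinear_simps)
  qed
qed

locale commuting_shifted_derivations =
  shifted_derivation scale mult b D + E: shifted_derivation scale mult e E
  for scale :: "complex \<Rightarrow> 'a::ab_group_add \<Rightarrow> 'a" and mult :: "'a \<Rightarrow> 'a \<Rightarrow> 'a"
    and b e :: complex and D E :: "'a \<Rightarrow> 'a" +
  assumes maps_commute: "D (E u) = E (D u)"
begin

lemma lie_algebra_shifted: "lie_algebra scale (bracket2 mult D E)"
proof -
  interpret br: complex_algebra scale "bracket2 mult D E"
    by (rule complex_algebraI[OF vector_space_axioms])
      (simp_all add: bracket2_def bilinear_simps shifted_simps E.shifted_simps algebra_simps)
  show ?thesis
  proof unfold_locales
    show "bracket2 mult D E u u = 0" for u
      by (simp add: bracket2_def commute)
    \<comment> \<open>The terms carrying \<open>b\<close> and \<open>e\<close> are cyclic sums of Eu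
      [v,w] and Du [v,w]. These are 3x3 determinants with a repeated row, hence zero; the rest is
      the Jacobi identity for commuting derivations.\<close>
    show "bracket2 mult D E u (bracket2 mult D E v w) + bracket2 mult D E v (bracket2 mult D E w u)
      + bracket2 mult D E w (bracket2 mult D E u v) = 0" for u v w
      by (simp add: bracket2_def bilinear_simps shifted_simps E.shifted_simps maps_commute
          assoc commute left_commute algebra_simps)
  qed
qed

text \<open>In the compatibility identity the \<open>e\<close> terms are multiples of w Du Dv and
  vanish on antisymmetrizing in \<open>u\<close>, \<open>v\<close>. The \<open>b\<close> terms of
  [w Du, v] - [w Dv, u] cancel against those of w D[u,v].\<close>

lemma gelfand_dorfman_shifted:
  "gelfand_dorfman_bialgebra scale (bracket2 mult D E) (\<lambda>u v. mult u (D v))"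
proof -
  interpret br: lie_algebra scale "bracket2 mult D E"
    by (rule lie_algebra_shifted)
  interpret circ: novikov_algebra scale "\<lambda>u v. mult u (D v)"
    by (rule novikov_algebra_shifted)
  show ?thesis
    by unfold_locales
      (simp add: bracket2_def bilinear_simps shifted_simps E.shifted_simps maps_commute
        assoc commute left_commute algebra_simps)
qed

end

context lie_algebra
begin

lemma antisymmetric: "br v u = - br u v"
proof -
  have "br v u + br u v = 0"
    using alternating[of "u + v"] unfolding bilinear_simps by (simp add: alternating)
  then show ?thesis
    by (simp only: eq_neg_iff_add_eq_0)
qed

lemma lie_algebra_opposite: "lie_algebra scale (\<lambda>u v. br v u)"
proof -
  interpret opp: complex_algebra scale "\<lambda>u v. br v u"
    by (rule complex_algebraI[OF vector_space_axioms]) (simp_all add: bilinear_simps)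
  show ?thesis
  proof unfold_locales
    show "br u u = 0" for u
      by (fact alternating)
    have "br (br w v) u = br u (br v w)" for u v w
      \<comment> \<open>The instances at 0 give \<open>br u 0 = 0\<close> and let signs move out of
        the second argument; the two sign changes then cancel.\<close>
      using diff_right[of u 0 "br w v"] diff_right[of u 0 0]
      by (simp add: antisymmetric[of u "br w v"] antisymmetric[of v w])
    then show "br (br w v) u + br (br u w) v + br (br v u) w = 0" for u v w
      by (simp add: Jacobi)
  qed
qed

end

text \<open>Compatibility is linear in the bracket, so reversing the bracket only negates its
  left-hand side.\<close>

lemma (in gelfand_dorfman_bialgebra) gelfand_dorfman_opposite:
  "gelfand_dorfman_bialgebra scale (\<lambda>u v. br v u) circ"
proof -
  interpret opp: lie_algebra scale "\<lambda>u v. br v u"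
    by (rule lie_algebra_opposite)
  show ?thesis
  proof unfold_locales
    have circ_br: "circ (br w u) v = - circ (br u w) v" for u v w
      using diff_left[of 0 "br u w" v] diff_left[of 0 0 v] antisymmetric[of w u] by simp
    have br_circ: "circ w (br v u) = - circ w (br u v)" for u v w
      using diff_right[of w 0 "br u v"] diff_right[of w 0 0] antisymmetric[of v u] by simp
    show "br v (circ w u) - br u (circ w v) + circ (br u w) v - circ (br v w) u
        - circ w (br v u) = 0" (is "?lhs = 0") for u v w
    proof -
      have "?lhs = - (br (circ w u) v - br (circ w v) u + circ (br w u) v - circ (br w v) u
          - circ w (br u v))"
        unfolding antisymmetric[of v "circ w u"] antisymmetric[of u "circ w v"]
          circ_br[of u w v] circ_br[of v w u] br_circ[of w v u]
        by simp
      then show ?thesis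
        by (simp only: compatibility minus_zero)
    qed
  qed
qed

theorem theorem3p5:
  fixes scale :: "complex \<Rightarrow> 'a::ab_group_add \<Rightarrow> 'a"
    and mult :: "'a \<Rightarrow> 'a \<Rightarrow> 'a"
    and d1 d2 :: "'a \<Rightarrow> 'a"
    and b :: complex
  assumes "comm_assoc_algebra scale mult"
    and "derivation scale mult d1"
    and "derivation scale mult d2"
    and "\<And>u. d1 (d2 u) = d2 (d1 u)"
  shows "gelfand_dorfman_bialgebra scale
           (\<lambda>u v. bracket2 mult d1 d2 u v + bracket1 mult d2 u v)
           (novikov_product scale mult d2 0)
       \<and> gelfand_dorfman_bialgebra scale
           (\<lambda>u v. bracket2 mult d2 d1 u v + scale b (bracket1 mult d1 u v))
           (novikov_product scale mult d2 b)"
proof -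
  interpret comm_assoc_algebra scale mult by (fact assms(1))
  have gd: "gelfand_dorfman_bialgebra scale
      (bracket2 mult (\<lambda>u. d2 u + scale c u) (\<lambda>u. d1 u + scale e u))
      (novikov_product scale mult d2 c)" for c e
  proof -
    interpret D: shifted_derivation scale mult c "\<lambda>u. d2 u + scale c u"
      by (rule shifted_derivationI) (fact assms(3))
    interpret E: shifted_derivation scale mult e "\<lambda>u. d1 u + scale e u"
      by (rule shifted_derivationI) (fact assms(2))
    \<comment> \<open>Linearity lets each derivation pass the other's scalar shift, so the shifted
      maps still commute.\<close>
    have "d2 (u + v) = d2 u + d2 v" "d2 (scale r u) = scale r (d2 u)"
      "d1 (u + v) = d1 u + d1 v" "d1 (scale r u) = scale r (d1 u)" for u v r
      using assms(2,3)[THEN derivation.linear_derivation] by (simp_all add: Vector_Spaces.linear_iff)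
    then interpret commuting_shifted_derivations scale mult c e
        "\<lambda>u. d2 u + scale c u" "\<lambda>u. d1 u + scale e u"
      by unfold_locales (simp add: assms(4) scale_right_distrib mult.commute add_ac)
    have "novikov_product scale mult d2 c = (\<lambda>u v. mult u (d2 v + scale c v))"
      by (simp add: novikov_product_def fun_eq_iff)
    then show ?thesis
      using gelfand_dorfman_shifted by simp
  qed
  \<comment> \<open>Here D = d2 and E = d1 + 1: the summand 1 in Eu Dv - Du Ev produces u d2(v) -
    d2(u) v. The order of \<open>D\<close> and \<open>E\<close> is forced by the product u Dv, hence
    the swapped arguments.\<close>
  have "(\<lambda>u v. bracket2 mult (\<lambda>u. d2 u + scale 0 u) (\<lambda>u. d1 u + scale 1 u) v u)
      = (\<lambda>u v. bracket2 mult d1 d2 u v + bracket1 mult d2 u v)"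
    by (simp add: fun_eq_iff bracket2_def bracket1_def bilinear_simps commute algebra_simps)
  \<comment> \<open>Now the shift \<open>b\<close> sits in D, where the Novikov product needs it,
    and yields \<open>b\<close> times the bracket of d1.\<close>
  moreover have "bracket2 mult (\<lambda>u. d2 u + scale b u) (\<lambda>u. d1 u + scale 0 u)
      = (\<lambda>u v. bracket2 mult d2 d1 u v + scale b (bracket1 mult d1 u v))"
    by (simp add: fun_eq_iff bracket2_def bracket1_def bilinear_simps algebra_simps)
  ultimately show ?thesis
    using gelfand_dorfman_bialgebra.gelfand_dorfman_opposite[OF gd[of 0 1]] gd[of b 0] by simp
qed

end
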